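(* Let $B$ be a left semi-brace and $I$ a subset of $B$. Then $I$ is an ideal of $B$ if and only if the following four conditions hold: 1. $I+0\subseteq I$; 2. $I\cap G$ is a normal subgroup of $(G,+)$; 3. $\lambda_g(I)\subseteq I$ for every $g\in G$; 4. $I$ is a normal subgroup of $(B,\circ)$.
   Context: A left semi-brace is a set $B$ with two operations $+$ and $\circ$ such that $(B,+)$ is a left cancellative semigroup (not necessarily commutative), $(B,\circ)$ is a group, and $a\circ(b+c)=a\circ b+a\circ(a^-+c)$ for all $a,b,c\in B$, where $a^-$ is the inverse of $a$ in $(B,\circ)$ and $\circ$ has higher precedence than $+$. The identity of $(B,\circ)$ is denoted $0$; it is an idempotent and a left identity of $(B,+)$. Let $E$ be the set of idempotents of $(B,+)$ and $G=B+0=\{b+0: b\in B\}$, which is a subgroup of $(B,+)$ (with identity $0$). For $X\subseteq B$, $X+0=\{x+0:x\in X\}$. For $a,b\in B$ put $\lambda_a(b)=a\circ(a^-+b)$ and $\rho_b(a)=(a^-+b)^-\circ b$. A subsemigroup $I$ of $(B,+)$ is an ideal of $B$ if: (i) $I$ is a normal subgroup of $(B,\circ)$; (ii) $I\cap G$ is a normal subgroup of $(G,+)$; (iii) $\rho_b(n)\in I$ for all $b\in B$, $n\in I\cap G$; (iv) $\lambda_g(e)\in I$ for all $g\in G$, $e\in I\cap E$. *)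

theory Defs
  imports "HOL-Algebra.Coset"
begin

text \<open>
  The underlying monoid record carries the multiplicative group: \<open>a \<otimes> b\<close> is
  \<open>a \<circ> b\<close>, and \<open>\<one>\<close> is its identity, usually written \<open>0\<close>, as it is also a left identity
  for \<open>\<oplus>\<close>. The symbol \<open>\<oplus>\<close> is not the ring addition of HOL-Algebra.
\<close>

record 'a semi_brace = "'a monoid" +
  sadd :: "['a, 'a] \<Rightarrow> 'a" (infixl \<open>\<oplus>\<index>\<close> 65)

locale left_semi_brace = group B for B :: "('a, 'b) semi_brace_scheme" (structure) +
  assumes sadd_closed [intro, simp]:
      "\<lbrakk>a \<in> carrier B; b \<in> carrier B\<rbrakk> \<Longrightarrow> a \<oplus> b \<in> carrier B"
    and sadd_assoc:
      "\<lbrakk>a \<in> carrier B; b \<in> carrier B; c \<in> carrier B\<rbrakk> \<Longrightarrow> (a \<oplus> b) \<oplus> c = a \<oplus> (b \<oplus> c)"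
    and sadd_left_cancel:
      "\<lbrakk>a \<in> carrier B; b \<in> carrier B; c \<in> carrier B; a \<oplus> b = a \<oplus> c\<rbrakk> \<Longrightarrow> b = c"
    and mult_sadd:
      "\<lbrakk>a \<in> carrier B; b \<in> carrier B; c \<in> carrier B\<rbrakk>
       \<Longrightarrow> a \<otimes> (b \<oplus> c) = a \<otimes> b \<oplus> a \<otimes> (inv a \<oplus> c)"

definition sb_lambda :: "('a, 'b) semi_brace_scheme \<Rightarrow> 'a \<Rightarrow> 'a \<Rightarrow> 'a" where
  "sb_lambda B a b = a \<otimes>\<^bsub>B\<^esub> (inv\<^bsub>B\<^esub> a \<oplus>\<^bsub>B\<^esub> b)"

text \<open>The subscript comes first: \<open>sb_rho B b a\<close> is \<open>\<rho>\<^sub>b(a)\<close>.\<close>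

definition sb_rho :: "('a, 'b) semi_brace_scheme \<Rightarrow> 'a \<Rightarrow> 'a \<Rightarrow> 'a" where
  "sb_rho B b a = inv\<^bsub>B\<^esub> (inv\<^bsub>B\<^esub> a \<oplus>\<^bsub>B\<^esub> b) \<otimes>\<^bsub>B\<^esub> b"

definition idempotents :: "('a, 'b) semi_brace_scheme \<Rightarrow> 'a set" where
  "idempotents B = {e \<in> carrier B. e \<oplus>\<^bsub>B\<^esub> e = e}"

definition plus_zero :: "('a, 'b) semi_brace_scheme \<Rightarrow> 'a set \<Rightarrow> 'a set" where
  "plus_zero B X = {x \<oplus>\<^bsub>B\<^esub> \<one>\<^bsub>B\<^esub> | x. x \<in> X}"

text \<open>\<open>sb_add_group B\<close> is \<open>(G, +)\<close> with \<open>G = B + 0\<close>.\<close>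

definition sb_add_group :: "('a, 'b) semi_brace_scheme \<Rightarrow> 'a monoid" where
  "sb_add_group B = \<lparr>carrier = plus_zero B (carrier B), mult = sadd B, one = \<one>\<^bsub>B\<^esub>\<rparr>"

text \<open>
  The predicate \<open>\<lhd>\<close> includes that the ambient structure is a group. The following shows that,
  for \<open>sb_add_group B\<close>, this holds in every left semi-brace and so is no extra hypothesis.
\<close>

lemma (in left_semi_brace) one_sadd:
  assumes c: "c \<in> carrier B"
  shows "\<one> \<oplus> c = c"
proof -
  have "\<one> \<otimes> (\<one> \<oplus> c) = \<one> \<otimes> \<one> \<oplus> \<one> \<otimes> (inv \<one> \<oplus> c)"
    using c by (intro mult_sadd) auto
  then have "\<one> \<oplus> c = \<one> \<oplus> (\<one> \<oplus> c)"
    using c by simp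
  then show ?thesis
    using c sadd_left_cancel[of \<one> c "\<one> \<oplus> c"] by simp
qed

lemma (in left_semi_brace) group_sb_add_group: "group (sb_add_group B)"
proof (rule groupI)
  show "x \<otimes>\<^bsub>sb_add_group B\<^esub> y \<in> carrier (sb_add_group B)"
    if xy: "x \<in> carrier (sb_add_group B)" "y \<in> carrier (sb_add_group B)" for x y
  proof -
    obtain a b where "a \<in> carrier B" "b \<in> carrier B" "x = a \<oplus> \<one>" "y = b \<oplus> \<one>"
      using xy by (auto simp: sb_add_group_def plus_zero_def)
    then have "x \<oplus> y = (x \<oplus> b) \<oplus> \<one>" "x \<oplus> b \<in> carrier B"
      by (auto simp: sadd_assoc)
    then show ?thesis
      by (auto simp: sb_add_group_def plus_zero_def)
  qed
  show "\<one>\<^bsub>sb_add_group B\<^esub> \<in> carrier (sb_add_group B)"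
    using one_sadd[OF one_closed] by (force simp: sb_add_group_def plus_zero_def)
  show "x \<otimes>\<^bsub>sb_add_group B\<^esub> y \<otimes>\<^bsub>sb_add_group B\<^esub> z =
      x \<otimes>\<^bsub>sb_add_group B\<^esub> (y \<otimes>\<^bsub>sb_add_group B\<^esub> z)"
    if "x \<in> carrier (sb_add_group B)" "y \<in> carrier (sb_add_group B)"
      "z \<in> carrier (sb_add_group B)" for x y z
    using that by (auto simp: sb_add_group_def plus_zero_def sadd_assoc)
  show "\<one>\<^bsub>sb_add_group B\<^esub> \<otimes>\<^bsub>sb_add_group B\<^esub> x = x"
    if "x \<in> carrier (sb_add_group B)" for x
    using that by (auto simp: sb_add_group_def plus_zero_def one_sadd)
  show "\<exists>y\<in>carrier (sb_add_group B). y \<otimes>\<^bsub>sb_add_group B\<^esub> x = \<one>\<^bsub>sb_add_group B\<^esub>"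
    if xG: "x \<in> carrier (sb_add_group B)" for x
  proof -
    have ri: "\<exists>y. y \<in> carrier B \<and> u \<oplus> (y \<oplus> \<one>) = \<one>" if u: "u \<in> carrier B" for u
    proof -
      have "u \<oplus> u \<otimes> (inv u \<oplus> inv u) = u \<otimes> (\<one> \<oplus> inv u)"
        using u mult_sadd[of u \<one> "inv u"] by simp
      also have "\<dots> = \<one>"
        using u by (simp add: one_sadd)
      finally have *: "u \<oplus> u \<otimes> (inv u \<oplus> inv u) = \<one>" .
      have "u \<oplus> (u \<otimes> (inv u \<oplus> inv u) \<oplus> \<one>) = (u \<oplus> u \<otimes> (inv u \<oplus> inv u)) \<oplus> \<one>"
        using u by (intro sadd_assoc[symmetric]) auto
      then have "u \<oplus> (u \<otimes> (inv u \<oplus> inv u) \<oplus> \<one>) = \<one>"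
        unfolding * by (simp add: one_sadd)
      then show ?thesis
        using u by (intro exI[of _ "u \<otimes> (inv u \<oplus> inv u)"]) auto
    qed
    obtain a where a: "a \<in> carrier B" "x = a \<oplus> \<one>"
      using xG by (auto simp: sb_add_group_def plus_zero_def)
    then have x: "x \<in> carrier B" "x \<oplus> \<one> = x"
      by (auto simp: sadd_assoc one_sadd)
    obtain y where y: "y \<in> carrier B" "x \<oplus> (y \<oplus> \<one>) = \<one>"
      using ri[OF x(1)] by blast
    have "x \<oplus> ((y \<oplus> \<one>) \<oplus> x) = (x \<oplus> (y \<oplus> \<one>)) \<oplus> x"
      using x y(1) by (intro sadd_assoc[symmetric]) auto
    also have "\<dots> = x \<oplus> \<one>"
      using x y(2) by (simp add: one_sadd)
    finally have "(y \<oplus> \<one>) \<oplus> x = \<one>"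
      using x y(1) sadd_left_cancel[of x "(y \<oplus> \<one>) \<oplus> x" \<one>] by simp
    then show ?thesis
      using y(1) by (auto simp: sb_add_group_def plus_zero_def)
  qed
qed

definition sb_ideal :: "'a set \<Rightarrow> ('a, 'b) semi_brace_scheme \<Rightarrow> bool" where
  "sb_ideal I B \<longleftrightarrow>
     I \<subseteq> carrier B \<and> (\<forall>x\<in>I. \<forall>y\<in>I. x \<oplus>\<^bsub>B\<^esub> y \<in> I) \<and>
     I \<lhd> B \<and>
     I \<inter> carrier (sb_add_group B) \<lhd> sb_add_group B \<and>
     (\<forall>b\<in>carrier B. \<forall>n\<in>I \<inter> carrier (sb_add_group B). sb_rho B b n \<in> I) \<and>
     (\<forall>g\<in>carrier (sb_add_group B). \<forall>e\<in>I \<inter> idempotents B. sb_lambda B g e \<in> I)"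

end

theory Submission
  imports Defs
begin

text \<open>
  Everything rests on the map \<open>\<lambda>\<close>. It is an action of the group \<open>(B, \<circ>)\<close> on the semigroup
  \<open>(B, +)\<close> by endomorphisms, and it links the two operations through \<open>a \<circ> b = a + \<lambda>\<^sub>a(b)\<close>. The
  group \<open>G = B + 0\<close> is the stabiliser of \<open>0\<close> under this action, so it is also a subgroup of
  \<open>(B, \<circ>)\<close>. The idempotents are left identities of \<open>(B, +)\<close>; they are permuted by each \<open>\<lambda>\<^sub>a\<close>,
  and every \<open>b\<close> splits as \<open>b = (b + 0) + e\<close> with \<open>e\<close> idempotent. Finally,
  \<open>\<rho>\<^sub>b(n)\<close> is the inverse of \<open>b\<^sup>- \<circ> (n\<^sup>- + b)\<close> and, for a subgroup \<open>I\<close> of \<open>(B, \<circ>)\<close>, the set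
  \<open>I \<inter> G\<close> is closed under inverses of \<open>\<circ>\<close>; so the condition on \<open>\<rho>\<close> says that
  \<open>b\<^sup>- \<circ> (n + b) \<in> I\<close> for all \<open>b \<in> B\<close> and \<open>n \<in> I \<inter> G\<close>.

  Let \<open>I\<close> be an ideal. For \<open>g \<in> G\<close> and \<open>n \<in> I \<inter> G\<close>, put \<open>b = g\<^sup>-\<close> and use normality of
  \<open>I \<inter> G\<close> in \<open>(G, +)\<close> to write \<open>b + n = n' + b\<close> with \<open>n' \<in> I \<inter> G\<close>. Then
  \<open>\<lambda>\<^sub>g(n) = b\<^sup>- \<circ> (b + n) = b\<^sup>- \<circ> (n' + b) \<in> I\<close>. Together with the condition on idempotents
  and the splitting \<open>x = (x + 0) + e\<close>, which stays inside \<open>I\<close> when \<open>x \<in> I\<close>, this gives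
  \<open>\<lambda>\<^sub>g(I) \<subseteq> I\<close>.

  Conversely, closure of \<open>I\<close> under \<open>+\<close> follows from \<open>x + y = (x + 0) \<circ> \<lambda>\<^sub>h(y)\<close>, where
  \<open>h = (x + 0)\<^sup>-\<close>. For the condition on \<open>\<rho>\<close>, write \<open>b = g + e = g \<circ> f\<close> with \<open>g = b + 0\<close>
  and \<open>e\<close>, \<open>f\<close> idempotent. For \<open>n \<in> I \<inter> G\<close>, moving \<open>n\<close> past \<open>g\<close> and applying \<open>\<lambda>\<close> gives
  \<open>n + b = g \<circ> (k + f)\<close> with \<open>k \<in> I\<close>. Hence \<open>b\<^sup>- \<circ> (n + b) = f\<^sup>- \<circ> (k + f)\<close>, and with
  \<open>k\<^sub>1 = f\<^sup>- \<circ> k \<circ> f \<in> I\<close> this equals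
  \<open>f\<^sup>- \<circ> k + 0 = k\<^sub>1 \<circ> f\<^sup>- + 0 = k\<^sub>1 + 0 \<in> I\<close>.
\<close>

lemma normal_swap_right:
  fixes G (structure)
  assumes "N \<lhd> G" "n \<in> N" "g \<in> carrier G"
  obtains n' where "n' \<in> N" "n \<otimes> g = g \<otimes> n'"
proof
  interpret normal N G by fact
  show "inv g \<otimes> n \<otimes> g \<in> N"
    using assms inv_op_closed1 by blast
  show "n \<otimes> g = g \<otimes> (inv g \<otimes> n \<otimes> g)"
    using assms(2,3) subset by (auto simp: m_assoc[symmetric])
qed

lemma normal_swap_left:
  fixes G (structure)
  assumes "N \<lhd> G" "n \<in> N" "g \<in> carrier G"
  obtains n' where "n' \<in> N" "g \<otimes> n = n' \<otimes> g"
proof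
  interpret normal N G by fact
  show "g \<otimes> n \<otimes> inv g \<in> N"
    using assms inv_op_closed2 by blast
  show "g \<otimes> n = g \<otimes> n \<otimes> inv g \<otimes> g"
    using assms(2,3) subset by (auto simp: m_assoc)
qed

context left_semi_brace
begin

lemma sb_lambda_closed [simp]:
  "\<lbrakk>a \<in> carrier B; b \<in> carrier B\<rbrakk> \<Longrightarrow> sb_lambda B a b \<in> carrier B"
  by (simp add: sb_lambda_def)

lemma mult_sadd_lambda:
  "\<lbrakk>a \<in> carrier B; b \<in> carrier B; c \<in> carrier B\<rbrakk> \<Longrightarrow> a \<otimes> (b \<oplus> c) = a \<otimes> b \<oplus> sb_lambda B a c"
  unfolding sb_lambda_def by (rule mult_sadd)

lemma mult_eq_sadd_lambda:
  "\<lbrakk>a \<in> carrier B; b \<in> carrier B\<rbrakk> \<Longrightarrow> a \<otimes> b = a \<oplus> sb_lambda B a b"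
  using mult_sadd_lambda[of a \<one> b] by (simp add: one_sadd)

lemma lambda_sadd:
  "\<lbrakk>a \<in> carrier B; b \<in> carrier B; c \<in> carrier B\<rbrakk>
   \<Longrightarrow> sb_lambda B a (b \<oplus> c) = sb_lambda B a b \<oplus> sb_lambda B a c"
  using mult_sadd_lambda[of a "inv a \<oplus> b" c] by (simp add: sb_lambda_def sadd_assoc)

lemma lambda_one [simp]: "b \<in> carrier B \<Longrightarrow> sb_lambda B \<one> b = b"
  by (simp add: sb_lambda_def one_sadd)

lemma lambda_mult:
  assumes "a \<in> carrier B" "b \<in> carrier B" "c \<in> carrier B"
  shows "sb_lambda B (a \<otimes> b) c = sb_lambda B a (sb_lambda B b c)"
proof -
  have "a \<otimes> b \<oplus> sb_lambda B (a \<otimes> b) c = a \<otimes> (b \<otimes> c)"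
    using assms by (simp add: mult_eq_sadd_lambda[of "a \<otimes> b" c, symmetric] m_assoc)
  also have "\<dots> = a \<otimes> b \<oplus> sb_lambda B a (sb_lambda B b c)"
    using assms by (simp add: mult_eq_sadd_lambda[of b c] mult_sadd_lambda)
  finally show ?thesis
    using assms sadd_left_cancel[of "a \<otimes> b"] by simp
qed

lemma lambda_inv [simp]:
  assumes "a \<in> carrier B" "b \<in> carrier B"
  shows "sb_lambda B a (sb_lambda B (inv a) b) = b"
  using lambda_mult[of a "inv a" b] assms by simp

lemma sadd_eq_mult_lambda:
  assumes "a \<in> carrier B" "b \<in> carrier B"
  shows "a \<oplus> b = a \<otimes> sb_lambda B (inv a) b"
  using assms by (simp add: mult_eq_sadd_lambda[of a "sb_lambda B (inv a) b"])

lemma rho_eq: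
  assumes "b \<in> carrier B" "n \<in> carrier B"
  shows "sb_rho B b n = inv (inv b \<otimes> (inv n \<oplus> b))"
  using assms by (simp add: sb_rho_def inv_mult_group)

lemma idempotent_sadd:
  assumes "e \<in> idempotents B" "b \<in> carrier B"
  shows "e \<oplus> b = b"
  using assms sadd_left_cancel[of e "e \<oplus> b" b]
  by (simp add: idempotents_def sadd_assoc[symmetric])

lemma lambda_idempotent:
  "\<lbrakk>a \<in> carrier B; e \<in> idempotents B\<rbrakk> \<Longrightarrow> sb_lambda B a e \<in> idempotents B"
  using lambda_sadd[of a e e] by (simp add: idempotents_def)

lemma idempotent_mult_eq_lambda:
  assumes "e \<in> idempotents B" "b \<in> carrier B"
  shows "e \<otimes> b = sb_lambda B e b"
  using assms
  by (metis (no_types, lifting) idempotent_sadd idempotents_def mem_Collect_eq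
      mult_eq_sadd_lambda sb_lambda_closed)

lemma inv_idempotent:
  assumes e: "e \<in> idempotents B"
  shows "inv e \<in> idempotents B"
proof -
  have ec: "e \<in> carrier B"
    using e by (simp add: idempotents_def)
  have "sb_lambda B e (inv e) = \<one>"
    using idempotent_mult_eq_lambda[OF e, of "inv e"] ec by simp
  then have "inv e = sb_lambda B (inv e) \<one>"
    using lambda_inv[of "inv e" "inv e"] ec by simp
  moreover have "\<one> \<in> idempotents B"
    by (simp add: idempotents_def one_sadd)
  ultimately show ?thesis
    using lambda_idempotent[of "inv e" \<one>] ec by simp
qed

lemma mult_sb_add_group [simp]: "x \<otimes>\<^bsub>sb_add_group B\<^esub> y = x \<oplus> y"
  by (simp add: sb_add_group_def)

lemma mem_sb_add_group_iff:
  "x \<in> carrier (sb_add_group B) \<longleftrightarrow> x \<in> carrier B \<and> x \<oplus> \<one> = x"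
proof
  show "x \<in> carrier (sb_add_group B) \<Longrightarrow> x \<in> carrier B \<and> x \<oplus> \<one> = x"
    by (auto simp: sb_add_group_def plus_zero_def sadd_assoc one_sadd)
  show "x \<in> carrier B \<and> x \<oplus> \<one> = x \<Longrightarrow> x \<in> carrier (sb_add_group B)"
    unfolding sb_add_group_def plus_zero_def by (simp, metis)
qed

lemma sadd_one_mem: "x \<in> carrier B \<Longrightarrow> x \<oplus> \<one> \<in> carrier (sb_add_group B)"
  by (auto simp: sb_add_group_def plus_zero_def)

lemma sb_add_group_eq_stabiliser:
  "x \<in> carrier (sb_add_group B) \<longleftrightarrow> x \<in> carrier B \<and> sb_lambda B x \<one> = \<one>"
  using mult_eq_sadd_lambda[of x \<one>] sadd_left_cancel[of x "sb_lambda B x \<one>" \<one>]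
  by (auto simp: mem_sb_add_group_iff)

lemma inv_mem_sb_add_group:
  assumes "g \<in> carrier (sb_add_group B)"
  shows "inv g \<in> carrier (sb_add_group B)"
  using assms lambda_inv[of "inv g" \<one>] by (auto simp: sb_add_group_eq_stabiliser)

text \<open>
  The idempotent part of \<open>x\<close> is \<open>y + x\<close>, where \<open>y\<close> is an inverse of \<open>x + 0\<close>. The element \<open>y\<close>
  is kept explicit so that for \<open>x\<close> in an ideal it can be taken in the ideal, and \<open>y + x\<close> with it.
\<close>

lemma sadd_idempotent_part:
  assumes x: "x \<in> carrier B" and y: "y \<in> carrier B" "(x \<oplus> \<one>) \<oplus> y = \<one>"
  shows "y \<oplus> x \<in> idempotents B" and "(x \<oplus> \<one>) \<oplus> (y \<oplus> x) = x"
proof -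
  show eq: "(x \<oplus> \<one>) \<oplus> (y \<oplus> x) = x"
    using x y by (simp add: sadd_assoc[of "x \<oplus> \<one>" y x, symmetric] one_sadd)
  then have "x \<oplus> (y \<oplus> x) = x"
    using x y by (simp add: sadd_assoc one_sadd)
  then show "y \<oplus> x \<in> idempotents B"
    using x y by (simp add: idempotents_def sadd_assoc)
qed

lemma sb_add_group_inverse_sadd:
  assumes "g \<in> carrier (sb_add_group B)"
  shows "g \<oplus> inv\<^bsub>sb_add_group B\<^esub> g = \<one>"
  using group.r_inv[OF group_sb_add_group assms] by (simp add: sb_add_group_def)

lemma sb_decomposition:
  assumes "b \<in> carrier B"
  obtains e where "e \<in> idempotents B" "b = (b \<oplus> \<one>) \<oplus> e"
proof -
  let ?y = "inv\<^bsub>sb_add_group B\<^esub> (b \<oplus> \<one>)"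
  have "?y \<in> carrier B"
    using group.inv_closed[OF group_sb_add_group sadd_one_mem[OF assms]]
    by (simp add: mem_sb_add_group_iff)
  then show ?thesis
    using that sadd_idempotent_part[OF assms] sb_add_group_inverse_sadd[OF sadd_one_mem[OF assms]]
    by metis
qed

text \<open>
  In an ideal, the conditions on \<open>\<rho>\<close> and on idempotents together yield invariance under \<open>\<lambda>\<^sub>g\<close>.
\<close>

lemma ideal_lambda_invariant:
  assumes I: "sb_ideal I B" and g: "g \<in> carrier (sb_add_group B)" and x: "x \<in> I"
  shows "sb_lambda B g x \<in> I"
proof -
  let ?N = "I \<inter> carrier (sb_add_group B)"
  have sub: "I \<subseteq> carrier B" and add: "\<And>x y. \<lbrakk>x \<in> I; y \<in> I\<rbrakk> \<Longrightarrow> x \<oplus> y \<in> I"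
    and normal: "I \<lhd> B" and N: "?N \<lhd> sb_add_group B"
    and rho: "\<And>b n. \<lbrakk>b \<in> carrier B; n \<in> ?N\<rbrakk> \<Longrightarrow> sb_rho B b n \<in> I"
    and idem: "\<And>e. e \<in> I \<inter> idempotents B \<Longrightarrow> sb_lambda B g e \<in> I"
    using I g unfolding sb_ideal_def by auto
  interpret I: normal I B by (rule normal)
  interpret N: normal ?N "sb_add_group B" by (rule N)
  have gc: "g \<in> carrier B"
    using g by (simp add: mem_sb_add_group_iff)
  have on_N: "sb_lambda B g n \<in> I" if n: "n \<in> ?N" for n
  proof -
    obtain n' where n': "n' \<in> ?N" "inv g \<oplus> n = n' \<oplus> inv g"
      using normal_swap_left[OF N n inv_mem_sb_add_group[OF g]] by auto
    have c: "n \<in> carrier B" "n' \<in> carrier B"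
      using n n' sub by auto
    have "inv n' \<in> ?N"
      using n'(1) inv_mem_sb_add_group by auto
    then have "inv (g \<otimes> (inv g \<oplus> n)) \<in> I"
      using rho[of "inv g" "inv n'"] rho_eq[of "inv g" "inv n'"] gc c n'(2) by simp
    then show ?thesis
      using gc c I.m_inv_closed[of "inv (g \<otimes> (inv g \<oplus> n))"] by (simp add: sb_lambda_def)
  qed
  have xc: "x \<in> carrier B"
    using x sub by auto
  let ?y = "inv\<^bsub>sb_add_group B\<^esub> (x \<oplus> \<one>)"
  have xN: "x \<oplus> \<one> \<in> ?N"
    using add[OF x I.one_closed] sadd_one_mem[OF xc] by simp
  then have yN: "?y \<in> ?N"
    by (rule N.m_inv_closed)
  then have yc: "?y \<in> carrier B"
    using sub by auto
  have e: "?y \<oplus> x \<in> idempotents B" "(x \<oplus> \<one>) \<oplus> (?y \<oplus> x) = x"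
    using sadd_idempotent_part[OF xc yc sb_add_group_inverse_sadd[OF sadd_one_mem[OF xc]]] .
  have "sb_lambda B g (?y \<oplus> x) \<in> I"
    using e(1) yN x add by (intro idem) auto
  then have "sb_lambda B g (x \<oplus> \<one>) \<oplus> sb_lambda B g (?y \<oplus> x) \<in> I"
    using on_N[OF xN] add by blast
  then show ?thesis
    using lambda_sadd[of g "x \<oplus> \<one>" "?y \<oplus> x"] gc xc yc e(2) by simp
qed

text \<open>
  The step named \<open>shift\<close> is the condition on \<open>\<rho>\<close> for an idempotent \<open>f\<close> in place of \<open>b\<close>, but
  for every \<open>k \<in> I\<close>. The action of \<open>f\<^sup>-\<close> sends \<open>f\<close> to \<open>0\<close>, and any idempotent followed by \<open>0\<close> is \<open>0\<close>.
\<close>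

lemma ideal_of_lambda_invariant:
  assumes zero: "plus_zero B I \<subseteq> I"
    and N: "I \<inter> carrier (sb_add_group B) \<lhd> sb_add_group B"
    and lam: "\<And>g x. \<lbrakk>g \<in> carrier (sb_add_group B); x \<in> I\<rbrakk> \<Longrightarrow> sb_lambda B g x \<in> I"
    and normal: "I \<lhd> B"
  shows "sb_ideal I B"
proof -
  let ?N = "I \<inter> carrier (sb_add_group B)"
  interpret I: normal I B by (rule normal)
  have sub: "I \<subseteq> carrier B"
    by (rule I.subset)
  have zero': "x \<oplus> \<one> \<in> I" if "x \<in> I" for x
    using zero that by (auto simp: plus_zero_def)
  have add: "x \<oplus> y \<in> I" if x: "x \<in> I" and y: "y \<in> I" for x y
  proof -
    have c: "x \<in> carrier B" "y \<in> carrier B"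
      using x y sub by auto
    have "sb_lambda B (inv (x \<oplus> \<one>)) y \<in> I"
      using c y by (intro lam inv_mem_sb_add_group sadd_one_mem)
    then have "(x \<oplus> \<one>) \<oplus> y \<in> I"
      using c zero'[OF x] by (simp add: sadd_eq_mult_lambda[of "x \<oplus> \<one>" y])
    then show ?thesis
      using c by (simp add: sadd_assoc one_sadd)
  qed
  have shift: "inv f \<otimes> (k \<oplus> f) \<in> I" if k: "k \<in> I" and f: "f \<in> idempotents B" for k f
  proof -
    have c: "k \<in> carrier B" "f \<in> carrier B"
      using k f sub by (auto simp: idempotents_def)
    define k1 where "k1 = inv f \<otimes> k \<otimes> f"
    have k1: "k1 \<in> I" "k1 \<in> carrier B"
      using I.inv_op_closed1[OF c(2) k] sub by (auto simp: k1_def)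
    have idem: "sb_lambda B k1 (inv f) \<in> idempotents B"
      using k1 f by (simp add: lambda_idempotent inv_idempotent)
    \<comment> \<open>The conjugate \<open>k1\<close> moves the factor from \<open>I\<close> to the left of \<open>inv f\<close>.\<close>
    have "inv f \<otimes> (k \<oplus> f) = inv f \<otimes> k \<oplus> sb_lambda B (inv f) f"
      using c by (simp add: mult_sadd_lambda)
    also have "sb_lambda B (inv f) f = \<one>"
      using idempotent_mult_eq_lambda[OF inv_idempotent[OF f] c(2)] c by simp
    also have "inv f \<otimes> k = k1 \<otimes> inv f"
      using c by (simp add: k1_def m_assoc)
    also have "\<dots> \<oplus> \<one> = k1 \<oplus> (sb_lambda B k1 (inv f) \<oplus> \<one>)"
      using c k1 by (simp add: mult_eq_sadd_lambda[of k1 "inv f"] sadd_assoc)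
    also have "\<dots> = k1 \<oplus> \<one>"
      using idempotent_sadd[OF idem] by simp
    finally show ?thesis
      using zero'[OF k1(1)] by simp
  qed
  have rho: "sb_rho B b n \<in> I" if b: "b \<in> carrier B" and n: "n \<in> ?N" for b n
  proof -
    have nc: "n \<in> carrier B"
      using n sub by auto
    obtain e where e: "e \<in> idempotents B" "b = (b \<oplus> \<one>) \<oplus> e"
      using sb_decomposition[OF b] .
    define g where "g = b \<oplus> \<one>"
    have g: "g \<in> carrier (sb_add_group B)" "g \<in> carrier B"
      using sadd_one_mem[OF b] b by (auto simp: g_def)
    have ec: "e \<in> carrier B"
      using e by (simp add: idempotents_def)
    have "inv n \<in> ?N"
      using n inv_mem_sb_add_group by auto
    then obtain m where m: "m \<in> ?N" "inv n \<oplus> g = g \<oplus> m"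
      using normal_swap_right[OF N _ g(1)] by auto
    have mc: "m \<in> carrier B"
      using m sub by auto
    define k f where "k = sb_lambda B (inv g) m" and "f = sb_lambda B (inv g) e"
    have f: "f \<in> idempotents B" "f \<in> carrier B"
      using lambda_idempotent[of "inv g" e] g e by (auto simp: f_def idempotents_def)
    have k: "k \<in> I" "k \<in> carrier B"
      using lam[OF inv_mem_sb_add_group[OF g(1)]] m g mc by (auto simp: k_def)
    have bgf: "b = g \<otimes> f"
      using e(2) sadd_eq_mult_lambda[OF g(2) ec] by (simp add: g_def[symmetric] f_def)
    have "inv n \<oplus> b = (inv n \<oplus> g) \<oplus> e"
      using e(2) g nc ec by (simp add: g_def[symmetric] sadd_assoc)
    also have "\<dots> = g \<oplus> (m \<oplus> e)"
      using g mc ec m(2) by (simp add: sadd_assoc)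
    also have "\<dots> = g \<otimes> (k \<oplus> f)"
      using g mc ec by (simp add: sadd_eq_mult_lambda[of g "m \<oplus> e"] lambda_sadd k_def f_def)
    finally have nb: "inv n \<oplus> b = g \<otimes> (k \<oplus> f)" .
    have "inv g \<otimes> (g \<otimes> (k \<oplus> f)) = k \<oplus> f"
      using g f k by (simp add: m_assoc[symmetric])
    then have "inv b \<otimes> (inv n \<oplus> b) = inv f \<otimes> (k \<oplus> f)"
      unfolding nb using g f k by (simp add: bgf inv_mult_group m_assoc)
    then show ?thesis
      using shift[OF k(1) f(1)] by (simp add: rho_eq[OF b nc])
  qed
  show ?thesis
    unfolding sb_ideal_def using sub add normal N rho lam by auto
qed

end

theorem theorem8:
  fixes B :: "('a, 'b) semi_brace_scheme" and I :: "'a set"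
  assumes "left_semi_brace B"
    and "I \<subseteq> carrier B"
  shows "sb_ideal I B \<longleftrightarrow>
     plus_zero B I \<subseteq> I \<and>
     I \<inter> carrier (sb_add_group B) \<lhd> sb_add_group B \<and>
     (\<forall>g\<in>carrier (sb_add_group B). sb_lambda B g ` I \<subseteq> I) \<and>
     I \<lhd> B"
proof
  interpret left_semi_brace B by fact
  assume I: "sb_ideal I B"
  then have "I \<lhd> B"
    by (simp add: sb_ideal_def)
  then have "\<one>\<^bsub>B\<^esub> \<in> I"
    by (intro subgroup.one_closed normal_imp_subgroup)
  then show "plus_zero B I \<subseteq> I \<and>
     I \<inter> carrier (sb_add_group B) \<lhd> sb_add_group B \<and>
     (\<forall>g\<in>carrier (sb_add_group B). sb_lambda B g ` I \<subseteq> I) \<and>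
     I \<lhd> B"
    using I ideal_lambda_invariant[OF I] by (auto simp: sb_ideal_def plus_zero_def)
next
  interpret left_semi_brace B by fact
  assume "plus_zero B I \<subseteq> I \<and>
     I \<inter> carrier (sb_add_group B) \<lhd> sb_add_group B \<and>
     (\<forall>g\<in>carrier (sb_add_group B). sb_lambda B g ` I \<subseteq> I) \<and>
     I \<lhd> B"
  then show "sb_ideal I B"
    by (intro ideal_of_lambda_invariant) auto
qed

end
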